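(* Let $U$ be a vector space over $\mathbb{K}$ equipped with an inner product $\langle\cdot,\cdot\rangle$ (regarded as a symmetric bilinear form). For all $u,v\in\mathcal{T}_S(U)$, $$\mathrm{Symm}(u\,\square\, v)=u\circ v,$$ where $\square$ is the square product on $\mathcal{T}(U)$ and $\circ$ is the circle product on $\mathcal{T}_S(U)$.
   Context: $\mathbb{K}$ is $\mathbb{R}$ or $\mathbb{C}$. $\mathcal{T}(U)=\bigoplus_{n\ge0}\bigotimes^nU$ is the tensor algebra with product $\otimes$ and unit $\mathbf{1}$, a Hopf algebra with co-multiplication $\Delta$ the algebra homomorphism determined by $\Delta(\mathbf{1})=\mathbf{1}\otimes\mathbf{1}$ and $\Delta(x)=\mathbf{1}\otimes x+x\otimes\mathbf{1}$ for $x\in U$; Sweedler notation: $\Delta(a)=\sum_{(a)}a_{(1)}\otimes a_{(2)}$. Laplace pairing on $\mathcal{T}(U)$: the unique symmetric bilinear form $(\cdot|\cdot)$ on $\mathcal{T}(U)$ with $(a|bc)=\sum_{(a)}(a_{(1)}|b)(a_{(2)}|c)$ for all $a,b,c$, $(\mathbf{1}|\mathbf{1})=1$, $(x|\mathbf{1})=(\mathbf{1}|x)=0$ and $(x|y)=\langle x,y\rangle$ for $x,y\in U$. Square product on $\mathcal{T}(U)$: $a\,\square\, b=\sum_{(a),(b)}(a_{(1)}|b_{(1)})\,a_{(2)}\otimes b_{(2)}$, where $a_{(2)}\otimes b_{(2)}$ is the product in $\mathcal{T}(U)$. $\mathrm{Symm}:\mathcal{T}(U)\to\mathcal{T}(U)$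 is the linear projection $\mathrm{Symm}(x_1\otimes\cdots\otimes x_n)=\frac1{n!}\sum_{p}x_{p(1)}\otimes\cdots\otimes x_{p(n)}$ ($p$ over all permutations of $\{1,\dots,n\}$), and $\mathcal{T}_S(U)=\mathrm{Symm}(\mathcal{T}(U))$ is the symmetric algebra with product $u\cdot v=\mathrm{Symm}(u\otimes v)$ and co-multiplication $\Delta_{symm}=(\mathrm{Symm}\otimes\mathrm{Symm})\circ\Delta$. Circle product on $\mathcal{T}_S(U)$: $u\circ v=\sum_{(u),(v)}(u_{(1)}|v_{(1)})\,u_{(2)}\cdot v_{(2)}$, where the Sweedler components are those of $\Delta_{symm}$, $(\cdot|\cdot)$ is the restriction of the Laplace pairing, and $\cdot$ is the product of $\mathcal{T}_S(U)$. *)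

theory Defs
  imports Complex_Main "HOL-Combinatorics.Permutations"
begin

text \<open>
  The ground field \<open>'k\<close> of the theorem has sort \<^class>\<open>real_normed_field\<close>. The types \<^typ>\<open>real\<close>
  and \<^typ>\<open>complex\<close> are instances, and by the Gelfand--Mazur theorem every instance is isomorphic
  to one of the two.
\<close>

definition bilinear_map ::
  "('k::field \<Rightarrow> 'a::ab_group_add \<Rightarrow> 'a) \<Rightarrow> ('k \<Rightarrow> 'b::ab_group_add \<Rightarrow> 'b)
    \<Rightarrow> ('k \<Rightarrow> 'c::ab_group_add \<Rightarrow> 'c) \<Rightarrow> ('a \<Rightarrow> 'b \<Rightarrow> 'c) \<Rightarrow> bool" where
  "bilinear_map s1 s2 s3 f \<longleftrightarrow>
     (\<forall>y. Vector_Spaces.linear s1 s3 (\<lambda>x. f x y)) \<and> (\<forall>x. Vector_Spaces.linear s2 s3 (f x))"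

text \<open>
  A function on lists is a family of functions \<open>U\<^sup>n \<rightarrow> W\<close>, one for each length \<open>n\<close>;
  here each of them has to be \<open>n\<close>-linear (no condition for \<open>n = 0\<close>).
\<close>

definition multilinear_on_lists ::
  "('k::field \<Rightarrow> 'u::ab_group_add \<Rightarrow> 'u) \<Rightarrow> ('k \<Rightarrow> 'w::ab_group_add \<Rightarrow> 'w)
    \<Rightarrow> ('u list \<Rightarrow> 'w) \<Rightarrow> bool" where
  "multilinear_on_lists s1 s2 f \<longleftrightarrow>
     (\<forall>xs ys. Vector_Spaces.linear s1 s2 (\<lambda>x. f (xs @ x # ys)))"

text \<open>
  The inner product enters only as a symmetric bilinear form, over \<^typ>\<open>complex\<close> too
  (bilinear, not sesquilinear), so definiteness is not required.
\<close>

locale symmetric_bilinear_form = vector_space scale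
  for scale :: "'k::field \<Rightarrow> 'u::ab_group_add \<Rightarrow> 'u" +
  fixes form :: "'u \<Rightarrow> 'u \<Rightarrow> 'k"
  assumes form_bilinear: "bilinear_map scale scale (*) form"
    and form_sym: "form x y = form y x"

locale unital_algebra = vector_space scale
  for scale :: "'k::field \<Rightarrow> 'a::ring_1 \<Rightarrow> 'a" +
  assumes scale_mult_left: "scale c a * b = scale c (a * b)"
    and scale_mult_right: "a * scale c b = scale c (a * b)"

definition algebra_hom ::
  "('k::field \<Rightarrow> 'a::ring_1 \<Rightarrow> 'a) \<Rightarrow> ('k \<Rightarrow> 'b::ring_1 \<Rightarrow> 'b) \<Rightarrow> ('a \<Rightarrow> 'b) \<Rightarrow> bool" where
  "algebra_hom s1 s2 f \<longleftrightarrow>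
     Vector_Spaces.linear s1 s2 f \<and> f 1 = 1 \<and> (\<forall>a b. f (a * b) = f a * f b)"

lemma separating_functional:
  fixes s :: "'k::field \<Rightarrow> 'a::ab_group_add \<Rightarrow> 'a"
  assumes vs: "vector_space s" and W: "v \<notin> module.span s W"
  shows "\<exists>g. Vector_Spaces.linear s (*) g \<and> (\<forall>w\<in>W. g w = 0) \<and> g v = 1"
proof -
  interpret vector_space s by fact
  interpret K: vector_space "(*) :: 'k \<Rightarrow> 'k \<Rightarrow> 'k"
    by unfold_locales (auto simp: algebra_simps)
  interpret P: vector_space_pair s "(*) :: 'k \<Rightarrow> 'k \<Rightarrow> 'k" ..
  obtain B where B: "B \<subseteq> W" "independent B" "W \<subseteq> span B"
    using maximal_independent_subset by blast
  have v: "v \<notin> span B" using W span_mono[OF B(1)] by blast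
  then have vB: "v \<notin> B" using span_base by blast
  have ind: "independent (insert v B)" using independent_insertI[OF v B(2)] .
  define g where "g = P.construct (insert v B) (\<lambda>b. if b = v then 1 else 0)"
  have lin: "Vector_Spaces.linear s (*) g"
    unfolding g_def by (rule P.linear_construct[OF ind])
  interpret g: Vector_Spaces.linear s "(*)" g by fact
  have gB: "g b = 0" if "b \<in> B" for b
    using that vB P.construct_basis[OF ind, of b "\<lambda>b. if b = v then 1 else 0"]
    unfolding g_def by auto
  have gspan: "g w = 0" if "w \<in> span B" for w
    using that by (induction rule: span_induct_alt) (auto simp: g.add g.scale gB)
  have "g v = 1"
    using P.construct_basis[OF ind, of v "\<lambda>b. if b = v then 1 else 0"]
    unfolding g_def by auto
  with lin gspan B(3) show ?thesis by blast
qed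

lemma linear_comp:
  "Vector_Spaces.linear s1 s2 f \<Longrightarrow> Vector_Spaces.linear s2 s3 g \<Longrightarrow>
    Vector_Spaces.linear s1 s3 (\<lambda>x. g (f x))"
  using Vector_Spaces.linear_compose[of s1 s2 f s3 g] by (simp add: o_def)

lemma scalar_universal_span:
  fixes s :: "'k::field \<Rightarrow> 'a::ab_group_add \<Rightarrow> 'a"
  assumes vs: "vector_space s"
    and u: "\<exists>!g. Vector_Spaces.linear s (*) g \<and> (\<forall>i. g (w i) = 0)"
  shows "module.span s (range w) = UNIV"
proof (rule ccontr)
  interpret vector_space s by fact
  assume "span (range w) \<noteq> UNIV"
  then obtain v where "v \<notin> span (range w)" by blast
  from separating_functional[OF vs this] obtain g
    where g: "Vector_Spaces.linear s (*) g" "\<And>i. g (w i) = 0" "g v = 1" by auto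
  have "Vector_Spaces.linear s (*) (\<lambda>_. 0::'k)"
    unfolding Vector_Spaces.linear_iff using vs by (auto simp: vector_space_def algebra_simps)
  then have "g = (\<lambda>_. 0)" using u g by (metis (mono_tags, lifting))
  with g(3) show False by simp
qed

lemma linear_eq_on_spanning:
  assumes "Vector_Spaces.linear s1 s2 f" "Vector_Spaces.linear s1 s2 g"
    and "module.span s1 (range w) = UNIV" "\<And>i. f (w i) = g (w i)"
  shows "f = g"
proof
  fix x
  interpret f: Vector_Spaces.linear s1 s2 f by fact
  interpret P: vector_space_pair s1 s2 ..
  show "f x = g x"
    by (rule P.linear_eq_on[OF assms(1,2), of x "range w"]) (use assms(3,4) in auto)
qed

lemma universal_from_scalar:
  fixes s1 :: "'k::field \<Rightarrow> 'a::ab_group_add \<Rightarrow> 'a"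
    and s2 :: "'k \<Rightarrow> 'b::ab_group_add \<Rightarrow> 'b"
  assumes vs1: "vector_space s1" and vs2: "vector_space s2"
    and span: "module.span s1 (range w) = UNIV"
    and ext: "\<And>h. Vector_Spaces.linear s2 (*) h \<Longrightarrow>
      \<exists>g. Vector_Spaces.linear s1 (*) g \<and> (\<forall>i. g (w i) = h (f i))"
  shows "\<exists>!g. Vector_Spaces.linear s1 s2 g \<and> (\<forall>i. g (w i) = f i)"
proof -
  interpret V1: vector_space s1 by fact
  interpret V2: vector_space s2 by fact
  interpret P: vector_space_pair s1 s2 ..
  obtain B where B: "B \<subseteq> range w" "V1.independent B" "range w \<subseteq> V1.span B"
    using V1.maximal_independent_subset by blast
  define r where "r b = (SOME i. w i = b)" for b
  have r: "w (r b) = b" if "b \<in> B" for b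
    unfolding r_def by (rule someI_ex) (use that B(1) in auto)
  define G where "G = P.construct B (\<lambda>b. f (r b))"
  have lin: "Vector_Spaces.linear s1 s2 G"
    unfolding G_def by (rule P.linear_construct[OF B(2)])
  have GB: "G b = f (r b)" if "b \<in> B" for b
    unfolding G_def using P.construct_basis[OF B(2) that] .
  have Gw: "G (w i) = f i" for i
  proof (rule ccontr)
    assume "G (w i) \<noteq> f i"
    then have "G (w i) - f i \<notin> V2.span {}" by simp
    from separating_functional[OF vs2 this] obtain h
      where h: "Vector_Spaces.linear s2 (*) h" "h (G (w i) - f i) = 1" by blast
    from ext[OF h(1)] obtain g
      where g: "Vector_Spaces.linear s1 (*) g" "\<And>i. g (w i) = h (f i)" by blast
    interpret h: Vector_Spaces.linear s2 "(*)" h by fact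
    interpret Q: vector_space_pair s1 "(*) :: 'k \<Rightarrow> 'k \<Rightarrow> 'k"
      by unfold_locales (auto simp: algebra_simps)
    have "h (G (w i)) = g (w i)"
    proof (rule Q.linear_eq_on[OF linear_comp[OF lin h(1)] g(1)])
      show "w i \<in> V1.span B" using B(3) by blast
      show "h (G b) = g b" if "b \<in> B" for b
        using g(2)[of "r b"] GB[OF that] r[OF that] by simp
    qed
    then show False using h(2) g(2)[of i] by (simp add: h.diff)
  qed
  show ?thesis
  proof (rule ex_ex1I)
    show "\<exists>g. Vector_Spaces.linear s1 s2 g \<and> (\<forall>i. g (w i) = f i)" using lin Gw by blast
    show "g = g'" if "Vector_Spaces.linear s1 s2 g \<and> (\<forall>i. g (w i) = f i)"
      "Vector_Spaces.linear s1 s2 g' \<and> (\<forall>i. g' (w i) = f i)" for g g'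
      by (rule linear_eq_on_spanning[of s1 s2 g g' w]) (use that span in auto)
  qed
qed

text \<open>
  \<open>\<T>(U) = \<Oplus>\<^sub>n \<Otimes>\<^sup>n U\<close>, up to unique isomorphism: products of elements of \<open>U\<close> are universal among
  families of \<open>n\<close>-linear maps on \<open>U\<^sup>n\<close>, \<open>n \<ge> 0\<close>. HOL cannot quantify over the type of the target,
  so the axiom is stated for the target \<open>'k\<close>. Over a field this implies the universal
  property for all targets, see \<open>tensor_universal\<close> and \<open>tensor_algebra_universal\<close> below.
\<close>

locale tensor_algebra = U: vector_space scaleU + T: unital_algebra scaleT
  for scaleU :: "'k::field \<Rightarrow> 'u::ab_group_add \<Rightarrow> 'u"
    and scaleT :: "'k \<Rightarrow> 't::ring_1 \<Rightarrow> 't" +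
  fixes emb :: "'u \<Rightarrow> 't"
  assumes emb_linear: "Vector_Spaces.linear scaleU scaleT emb"
    and scalar_universal:
      "multilinear_on_lists scaleU (*) f \<Longrightarrow>
        \<exists>!g. Vector_Spaces.linear scaleT (*) g \<and> (\<forall>xs. g (prod_list (map emb xs)) = f xs)"

context tensor_algebra
begin

abbreviation word :: "'u list \<Rightarrow> 't" where
  "word xs \<equiv> prod_list (map emb xs)"

lemma words_span: "T.span (range word) = UNIV"
proof (rule scalar_universal_span[OF T.vector_space_axioms])
  have "multilinear_on_lists scaleU (*) (\<lambda>_. 0::'k)"
    unfolding multilinear_on_lists_def Vector_Spaces.linear_iff
    using U.vector_space_axioms by (auto simp: vector_space_def algebra_simps)
  from scalar_universal[OF this]
  show "\<exists>!g. Vector_Spaces.linear scaleT (*) g \<and> (\<forall>xs. g (word xs) = 0)" .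
qed

lemma tensor_universal:
  fixes s :: "'k \<Rightarrow> 'w::ab_group_add \<Rightarrow> 'w"
  assumes s: "vector_space s" and f: "multilinear_on_lists scaleU s f"
  shows "\<exists>!g. Vector_Spaces.linear scaleT s g \<and> (\<forall>xs. g (word xs) = f xs)"
proof (rule universal_from_scalar[OF T.vector_space_axioms s words_span])
  fix h :: "'w \<Rightarrow> 'k" assume h: "Vector_Spaces.linear s (*) h"
  have "multilinear_on_lists scaleU (*) (\<lambda>xs. h (f xs))"
    using f linear_comp[OF _ h] unfolding multilinear_on_lists_def by blast
  from ex1_implies_ex[OF scalar_universal[OF this]]
  show "\<exists>g. Vector_Spaces.linear scaleT (*) g \<and> (\<forall>xs. g (word xs) = h (f xs))" .
qed

lemma linear_eq_on_words:
  assumes "Vector_Spaces.linear scaleT s f" "Vector_Spaces.linear scaleT s g"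
    and "\<And>xs. f (word xs) = g (word xs)"
  shows "f = g"
  using linear_eq_on_spanning[OF assms(1,2) words_span] assms(3) by blast

lemma tensor_algebra_universal:
  fixes s :: "'k \<Rightarrow> 'a::ring_1 \<Rightarrow> 'a"
  assumes A: "unital_algebra s" and phi: "Vector_Spaces.linear scaleU s \<phi>"
  shows "\<exists>!h. algebra_hom scaleT s h \<and> (\<forall>x. h (emb x) = \<phi> x)"
proof -
  interpret A: unital_algebra s by fact
  interpret phi: Vector_Spaces.linear scaleU s \<phi> by fact
  have word: "h (word xs) = prod_list (map \<phi> xs)"
    if "algebra_hom scaleT s h" "\<And>x. h (emb x) = \<phi> x" for h xs
    using that by (induction xs) (auto simp: algebra_hom_def)
  have "multilinear_on_lists scaleU s (\<lambda>xs. prod_list (map \<phi> xs))"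
    unfolding multilinear_on_lists_def Vector_Spaces.linear_iff
    by (auto simp: phi.add phi.scale algebra_simps A.scale_mult_left A.scale_mult_right
        U.vector_space_axioms A.vector_space_axioms)
  from ex1_implies_ex[OF tensor_universal[OF A.vector_space_axioms this]] obtain h
    where lin: "Vector_Spaces.linear scaleT s h"
      and h: "\<And>xs. h (word xs) = prod_list (map \<phi> xs)" by blast
  interpret h: Vector_Spaces.linear scaleT s h by fact
  have lm: "Vector_Spaces.linear scaleT s (\<lambda>a. h (a * b))"
    "Vector_Spaces.linear scaleT s (\<lambda>a. h (b * a))"
    "Vector_Spaces.linear scaleT s (\<lambda>a. h a * h b)"
    "Vector_Spaces.linear scaleT s (\<lambda>a. h b * h a)" for b
    unfolding Vector_Spaces.linear_iff
    by (auto simp: h.add h.scale algebra_simps T.scale_mult_left T.scale_mult_right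
        A.scale_mult_left A.scale_mult_right T.vector_space_axioms A.vector_space_axioms)
  have 1: "h (word xs * word ys) = h (word xs) * h (word ys)" for xs ys
    using h[of "xs @ ys"] h by simp
  have 2: "h (a * word ys) = h a * h (word ys)" for a ys
    by (rule fun_cong[OF linear_eq_on_words[OF lm(1,3)]]) (rule 1)
  have 3: "h (a * b) = h a * h b" for a b
    by (rule fun_cong[OF linear_eq_on_words[OF lm(2,4)]]) (rule 2)
  have hom: "algebra_hom scaleT s h" "h (emb x) = \<phi> x" for x
    using lin 3 h[of "[]"] h[of "[x]"] by (auto simp: algebra_hom_def)
  show ?thesis
  proof (rule ex_ex1I)
    show "\<exists>h. algebra_hom scaleT s h \<and> (\<forall>x. h (emb x) = \<phi> x)" using hom by blast
    show "h = h'" if "algebra_hom scaleT s h \<and> (\<forall>x. h (emb x) = \<phi> x)"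
      "algebra_hom scaleT s h' \<and> (\<forall>x. h' (emb x) = \<phi> x)" for h h'
      using that word[of h] word[of h']
      by (intro linear_eq_on_words) (auto simp: algebra_hom_def)
  qed
qed

end

text \<open>
  The tensor algebra together with the tensor product algebra \<open>\<T>(U) \<otimes> \<T>(U)\<close>, written \<open>'tt\<close>.
  The outer tensor product is written \<open>\<boxtimes>\<close>; the product \<open>\<otimes>\<close> inside \<open>\<T>(U)\<close> is \<open>*\<close>.
\<close>

locale tensor_algebra_square = tensor_algebra scaleU scaleT emb + TT: unital_algebra scaleTT
  for scaleU :: "'k::field_char_0 \<Rightarrow> 'u::ab_group_add \<Rightarrow> 'u"
    and scaleT :: "'k \<Rightarrow> 't::ring_1 \<Rightarrow> 't"
    and emb :: "'u \<Rightarrow> 't"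
    and scaleTT :: "'k \<Rightarrow> 'tt::ring_1 \<Rightarrow> 'tt" +
  fixes tens :: "'t \<Rightarrow> 't \<Rightarrow> 'tt"  (infixl "\<boxtimes>" 70)
  assumes tens_bilinear: "bilinear_map scaleT scaleT scaleTT (\<boxtimes>)"
    and tens_scalar_universal:
      "bilinear_map scaleT scaleT (*) f \<Longrightarrow>
        \<exists>!g. Vector_Spaces.linear scaleTT (*) g \<and> (\<forall>a b. g (a \<boxtimes> b) = f a b)"
    and tens_mult: "(a \<boxtimes> b) * (c \<boxtimes> d) = (a * c) \<boxtimes> (b * d)"
    and tens_one: "1 = 1 \<boxtimes> 1"
begin

lemma scalar_vector_space: "vector_space ((*) :: 'k \<Rightarrow> 'k \<Rightarrow> 'k)"
  by unfold_locales (auto simp: algebra_simps)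

lemma tens_span: "TT.span (range (\<lambda>(a, b). a \<boxtimes> b)) = UNIV"
proof (rule scalar_universal_span[OF TT.vector_space_axioms])
  have "bilinear_map scaleT scaleT (*) (\<lambda>_ _. 0::'k)"
    unfolding bilinear_map_def Vector_Spaces.linear_iff
    using T.vector_space_axioms scalar_vector_space by auto
  from tens_scalar_universal[OF this]
  show "\<exists>!g. Vector_Spaces.linear scaleTT (*) g \<and>
      (\<forall>i. g (case i of (a, b) \<Rightarrow> a \<boxtimes> b) = 0)"
    by (simp add: split_paired_All)
qed

lemma tens_universal:
  fixes s :: "'k \<Rightarrow> 'w::ab_group_add \<Rightarrow> 'w"
  assumes s: "vector_space s" and f: "bilinear_map scaleT scaleT s f"
  shows "\<exists>!g. Vector_Spaces.linear scaleTT s g \<and> (\<forall>a b. g (a \<boxtimes> b) = f a b)"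
proof -
  have "\<exists>!g. Vector_Spaces.linear scaleTT s g \<and>
      (\<forall>i. g (case i of (a, b) \<Rightarrow> a \<boxtimes> b) = (case i of (a, b) \<Rightarrow> f a b))"
  proof (rule universal_from_scalar[OF TT.vector_space_axioms s tens_span])
    fix h :: "'w \<Rightarrow> 'k" assume h: "Vector_Spaces.linear s (*) h"
    have "bilinear_map scaleT scaleT (*) (\<lambda>a b. h (f a b))"
      using f linear_comp[OF _ h] unfolding bilinear_map_def by blast
    from ex1_implies_ex[OF tens_scalar_universal[OF this]]
    show "\<exists>g. Vector_Spaces.linear scaleTT (*) g \<and>
        (\<forall>i. g (case i of (a, b) \<Rightarrow> a \<boxtimes> b) = h (case i of (a, b) \<Rightarrow> f a b))"
      by auto
  qed
  then show ?thesis by (simp add: split_paired_All)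
qed

lemma tens_scale: "scaleTT c (a \<boxtimes> b) = scaleT c a \<boxtimes> b" "scaleTT c (a \<boxtimes> b) = a \<boxtimes> scaleT c b"
  using tens_bilinear unfolding bilinear_map_def Vector_Spaces.linear_iff by auto

lemma tens_add: "(a + a') \<boxtimes> b = a \<boxtimes> b + a' \<boxtimes> b" "a \<boxtimes> (b + b') = a \<boxtimes> b + a \<boxtimes> b'"
  using tens_bilinear unfolding bilinear_map_def Vector_Spaces.linear_iff by auto

lemma tens_decomposition: "\<exists>ps. w = (\<Sum>(a, b)\<leftarrow>ps. a \<boxtimes> b)"
proof -
  have "w \<in> TT.span (range (\<lambda>(a, b). a \<boxtimes> b))" using tens_span by simp
  then show ?thesis
  proof (induction rule: TT.span_induct_alt)
    case base
    show ?case by (rule exI[of _ "[]"]) simp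
  next
    case (step c x y)
    then obtain a b ps where "x = a \<boxtimes> b" "y = (\<Sum>(a, b)\<leftarrow>ps. a \<boxtimes> b)" by auto
    then show ?case by (intro exI[of _ "(scaleT c a, b) # ps"]) (simp add: tens_scale)
  qed
qed

definition Symm :: "'t \<Rightarrow> 't" where
  "Symm = (THE S. Vector_Spaces.linear scaleT scaleT S \<and>
     (\<forall>xs. S (prod_list (map emb xs)) =
        scaleT (1 / fact (length xs))
          (\<Sum>p | p permutes {..<length xs}. prod_list (map emb (permute_list p xs)))))"

definition TS :: "'t set" where
  "TS = range Symm"

definition sym_mult :: "'t \<Rightarrow> 't \<Rightarrow> 't"  (infixl "\<odot>" 70) where
  "u \<odot> v = Symm (u * v)"

definition comult :: "'t \<Rightarrow> 'tt" where
  "comult = (THE D. algebra_hom scaleT scaleTT D \<and>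
     (\<forall>x. D (emb x) = 1 \<boxtimes> emb x + emb x \<boxtimes> 1))"

definition tensor_map :: "('t \<Rightarrow> 't) \<Rightarrow> ('t \<Rightarrow> 't) \<Rightarrow> 'tt \<Rightarrow> 'tt" where
  "tensor_map f g = (THE h. Vector_Spaces.linear scaleTT scaleTT h \<and>
     (\<forall>a b. h (a \<boxtimes> b) = f a \<boxtimes> g b))"

definition comult_symm :: "'t \<Rightarrow> 'tt" where
  "comult_symm = tensor_map Symm Symm \<circ> comult"

text \<open>
  Sweedler notation: \<open>sweedler A D \<beta> a\<close> is \<open>\<Sum>\<^bsub>(a)\<^esub> \<beta> a\<^bsub>(1)\<^esub> a\<^bsub>(2)\<^esub>\<close> for the co-multiplication \<open>D\<close>, with
  Sweedler components taken in the subspace \<open>A\<close>. It depends on the chosen decomposition of \<open>D a\<close>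
  only when \<open>\<beta>\<close> is not bilinear, see \<open>sweedler_eq\<close>. The tensor square of a subspace \<open>A\<close> is
  viewed inside \<open>\<T>(U) \<otimes> \<T>(U)\<close>.
\<close>

definition decomp :: "'t set \<Rightarrow> 'tt \<Rightarrow> ('t \<times> 't) list" where
  "decomp A w = (SOME ps. set ps \<subseteq> A \<times> A \<and> w = (\<Sum>(a, b)\<leftarrow>ps. a \<boxtimes> b))"

definition sweedler :: "'t set \<Rightarrow> ('t \<Rightarrow> 'tt) \<Rightarrow> ('t \<Rightarrow> 't \<Rightarrow> 'c) \<Rightarrow> 't \<Rightarrow> 'c::ab_group_add" where
  "sweedler A D \<beta> a = (\<Sum>(a1, a2)\<leftarrow>decomp A (D a). \<beta> a1 a2)"

definition is_laplace_pairing :: "('u \<Rightarrow> 'u \<Rightarrow> 'k) \<Rightarrow> ('t \<Rightarrow> 't \<Rightarrow> 'k) \<Rightarrow> bool" where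
  "is_laplace_pairing ip L \<longleftrightarrow>
     bilinear_map scaleT scaleT (*) L \<and>
     (\<forall>a b. L a b = L b a) \<and>
     (\<forall>a b c. L a (b * c) = sweedler UNIV comult (\<lambda>a1 a2. L a1 b * L a2 c) a) \<and>
     L 1 1 = 1 \<and>
     (\<forall>x. L (emb x) 1 = 0 \<and> L 1 (emb x) = 0) \<and>
     (\<forall>x y. L (emb x) (emb y) = ip x y)"

definition laplace :: "('u \<Rightarrow> 'u \<Rightarrow> 'k) \<Rightarrow> 't \<Rightarrow> 't \<Rightarrow> 'k" where
  "laplace ip = (THE L. is_laplace_pairing ip L)"

definition square_prod :: "('u \<Rightarrow> 'u \<Rightarrow> 'k) \<Rightarrow> 't \<Rightarrow> 't \<Rightarrow> 't" where
  "square_prod ip a b =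
     sweedler UNIV comult (\<lambda>a1 a2.
       sweedler UNIV comult (\<lambda>b1 b2. scaleT (laplace ip a1 b1) (a2 * b2)) b) a"

definition circle_prod :: "('u \<Rightarrow> 'u \<Rightarrow> 'k) \<Rightarrow> 't \<Rightarrow> 't \<Rightarrow> 't" where
  "circle_prod ip u v =
     sweedler TS comult_symm (\<lambda>u1 u2.
       sweedler TS comult_symm (\<lambda>v1 v2. scaleT (laplace ip u1 v1) (u2 \<odot> v2)) v) u"

lemma permute_word_linear:
  assumes p: "p permutes {..<Suc (length xs + length ys)}"
  shows "Vector_Spaces.linear scaleU scaleT (\<lambda>x. word (permute_list p (xs @ x # ys)))"
proof -
  interpret emb: Vector_Spaces.linear scaleU scaleT emb by (rule emb_linear)
  let ?n = "Suc (length xs + length ys)" and ?k = "length xs"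
  define i where "i = inv p ?k"
  have pi: "p i = ?k" unfolding i_def using permutes_inverses(1)[OF p] .
  have i: "i < ?n"
    using permutes_in_image[OF p, of i] pi by auto
  define l where "l x = permute_list p (xs @ x # ys)" for x
  have len: "length (l x) = ?n" for x by (simp add: l_def)
  have nth_l: "l x ! j = (if j = i then x else l 0 ! j)" if "j < ?n" for x j
  proof (cases "j = i")
    case False
    then have "p j \<noteq> ?k" using pi permutes_inj[OF p] by (metis injD)
    then show ?thesis using that False
      by (auto simp: l_def permute_list_def nth_append nth_Cons split: nat.splits simp del: upt_Suc)
  qed (use that pi in \<open>auto simp: l_def permute_list_def simp del: upt_Suc\<close>)
  have "l x = take i (l 0) @ x # drop (Suc i) (l 0)" for x
  proof -
    have "l x = (l 0)[i := x]"
    proof (rule nth_equalityI)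
      fix j assume "j < length (l x)"
      then show "l x ! j = (l 0)[i := x] ! j"
        using nth_l[of j x] i len by (cases "j = i") auto
    qed (simp add: len)
    then show ?thesis using upd_conv_take_nth_drop[of i "l 0" x] i len by simp
  qed
  then have "word (l x) = word (take i (l 0)) * (emb x * word (drop (Suc i) (l 0)))" for x
    by (metis list.simps(9) map_append prod_list.Cons prod_list.append)
  then have "Vector_Spaces.linear scaleU scaleT (\<lambda>x. word (l x))"
    unfolding Vector_Spaces.linear_iff
    by (auto simp: emb.add emb.scale algebra_simps T.scale_mult_left T.scale_mult_right
        U.vector_space_axioms T.vector_space_axioms)
  then show ?thesis by (simp add: l_def)
qed

lemma Symm_ex1:
  "\<exists>!S. Vector_Spaces.linear scaleT scaleT S \<and>
     (\<forall>xs. S (word xs) = scaleT (1 / fact (length xs))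
          (\<Sum>p | p permutes {..<length xs}. word (permute_list p xs)))"
proof (rule tensor_universal[OF T.vector_space_axioms])
  interpret P: vector_space_pair scaleU scaleT ..
  have "Vector_Spaces.linear scaleU scaleT (\<lambda>x. scaleT (1 / fact (length (xs @ x # ys)))
          (\<Sum>p | p permutes {..<length (xs @ x # ys)}. word (permute_list p (xs @ x # ys))))"
    for xs ys
    using permute_word_linear[of _ xs ys]
    by (auto intro!: P.linear_compose_scale_right P.linear_compose_sum)
  then show "multilinear_on_lists scaleU scaleT (\<lambda>xs. scaleT (1 / fact (length xs))
          (\<Sum>p | p permutes {..<length xs}. word (permute_list p xs)))"
    unfolding multilinear_on_lists_def by blast
qed

lemma Symm_linear: "Vector_Spaces.linear scaleT scaleT Symm"
  and Symm_word: "Symm (word xs) = scaleT (1 / fact (length xs))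
          (\<Sum>p | p permutes {..<length xs}. word (permute_list p xs))"
  using theI'[OF Symm_ex1] unfolding Symm_def by blast+

lemma comult_ex1:
  "\<exists>!D. algebra_hom scaleT scaleTT D \<and> (\<forall>x. D (emb x) = 1 \<boxtimes> emb x + emb x \<boxtimes> 1)"
proof (rule tensor_algebra_universal[OF TT.unital_algebra_axioms])
  interpret emb: Vector_Spaces.linear scaleU scaleT emb by (rule emb_linear)
  show "Vector_Spaces.linear scaleU scaleTT (\<lambda>x. 1 \<boxtimes> emb x + emb x \<boxtimes> 1)"
    unfolding Vector_Spaces.linear_iff
    by (auto simp: emb.add emb.scale tens_add tens_scale[symmetric] algebra_simps
        TT.scale_right_distrib U.vector_space_axioms TT.vector_space_axioms)
qed

lemma comult_hom: "algebra_hom scaleT scaleTT comult"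
  and comult_emb: "comult (emb x) = 1 \<boxtimes> emb x + emb x \<boxtimes> 1"
  using theI'[OF comult_ex1] unfolding comult_def by blast+

lemma tensor_map_ex1:
  assumes "Vector_Spaces.linear scaleT scaleT f" "Vector_Spaces.linear scaleT scaleT g"
  shows "\<exists>!h. Vector_Spaces.linear scaleTT scaleTT h \<and> (\<forall>a b. h (a \<boxtimes> b) = f a \<boxtimes> g b)"
proof (rule tens_universal[OF TT.vector_space_axioms])
  show "bilinear_map scaleT scaleT scaleTT (\<lambda>a b. f a \<boxtimes> g b)"
    using assms unfolding bilinear_map_def Vector_Spaces.linear_iff
    by (auto simp: tens_add tens_scale[symmetric] TT.vector_space_axioms)
qed

lemma sum_list_bilinear_eq:
  fixes s :: "'k \<Rightarrow> 'w::ab_group_add \<Rightarrow> 'w"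
  assumes s: "vector_space s" and f: "bilinear_map scaleT scaleT s f"
    and eq: "(\<Sum>(a, b)\<leftarrow>ps. a \<boxtimes> b) = (\<Sum>(a, b)\<leftarrow>qs. a \<boxtimes> b)"
  shows "(\<Sum>(a, b)\<leftarrow>ps. f a b) = (\<Sum>(a, b)\<leftarrow>qs. f a b)"
proof -
  obtain g where lin: "Vector_Spaces.linear scaleTT s g" and g: "\<And>a b. g (a \<boxtimes> b) = f a b"
    using ex1_implies_ex[OF tens_universal[OF s f]] by blast
  interpret g: Vector_Spaces.linear scaleTT s g by fact
  have "g (\<Sum>(a, b)\<leftarrow>rs. a \<boxtimes> b) = (\<Sum>(a, b)\<leftarrow>rs. f a b)" for rs
    by (induction rs) (auto simp: g.zero g.add g)
  then show ?thesis using eq by metis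
qed

lemma sweedler_eq:
  fixes s :: "'k \<Rightarrow> 'w::ab_group_add \<Rightarrow> 'w"
  assumes s: "vector_space s" and f: "bilinear_map scaleT scaleT s f"
    and ps: "set ps \<subseteq> A \<times> A" "D a = (\<Sum>(a, b)\<leftarrow>ps. a \<boxtimes> b)"
  shows "sweedler A D f a = (\<Sum>(a, b)\<leftarrow>ps. f a b)"
proof -
  have "D a = (\<Sum>(a, b)\<leftarrow>decomp A (D a). a \<boxtimes> b)"
    using someI[of "\<lambda>ps. set ps \<subseteq> A \<times> A \<and> D a = (\<Sum>(a, b)\<leftarrow>ps. a \<boxtimes> b)" ps] ps
    unfolding decomp_def by blast
  with ps(2) show ?thesis
    unfolding sweedler_def using sum_list_bilinear_eq[OF s f] by metis
qed

lemma comult_symm_decomposition: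
  "\<exists>ps. set ps \<subseteq> TS \<times> TS \<and> comult_symm a = (\<Sum>(a, b)\<leftarrow>ps. a \<boxtimes> b)"
proof -
  obtain ps where ps: "comult a = (\<Sum>(a, b)\<leftarrow>ps. a \<boxtimes> b)" using tens_decomposition by blast
  have lin: "Vector_Spaces.linear scaleTT scaleTT (tensor_map Symm Symm)"
    and tm: "\<And>a b. tensor_map Symm Symm (a \<boxtimes> b) = Symm a \<boxtimes> Symm b"
    using theI'[OF tensor_map_ex1[OF Symm_linear Symm_linear]] unfolding tensor_map_def by blast+
  interpret h: Vector_Spaces.linear scaleTT scaleTT "tensor_map Symm Symm" by fact
  have "tensor_map Symm Symm (\<Sum>(a, b)\<leftarrow>qs. a \<boxtimes> b) =
      (\<Sum>(a, b)\<leftarrow>map (\<lambda>(a, b). (Symm a, Symm b)) qs. a \<boxtimes> b)" for qs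
    by (induction qs) (auto simp: h.zero h.add tm)
  then have "comult_symm a = (\<Sum>(a, b)\<leftarrow>map (\<lambda>(a, b). (Symm a, Symm b)) ps. a \<boxtimes> b)"
    by (simp add: comult_symm_def ps)
  moreover have "set (map (\<lambda>(a, b). (Symm a, Symm b)) ps) \<subseteq> TS \<times> TS"
    by (auto simp: TS_def)
  ultimately show ?thesis by blast
qed

text \<open>
  Existence and uniqueness of the Laplace pairing. For \<open>x\<close> in \<open>U\<close>, the contraction by \<open>x\<close> is the
  derivation of \<open>\<T>(U)\<close> extending \<open>ip x\<close>; the pairing is \<open>(x\<^sub>1 \<cdots> x\<^sub>n | b) = \<epsilon> (d\<^bsub>x\<^sub>n\<^esub> (\<cdots> (d\<^bsub>x\<^sub>1\<^esub> b)))\<close>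
  with \<open>\<epsilon>\<close> the co-unit.
\<close>

lemma linear_eq_on_emb_mult:
  assumes "Vector_Spaces.linear scaleT s f" "Vector_Spaces.linear scaleT s g"
    and "f 1 = g 1"
    and "\<And>x xs. f (word xs) = g (word xs) \<Longrightarrow> f (emb x * word xs) = g (emb x * word xs)"
  shows "f = g"
proof (rule linear_eq_on_words[OF assms(1,2)])
  show "f (word xs) = g (word xs)" for xs
    by (induction xs) (use assms(3,4) in auto)
qed

lemma bilinear_scalarD:
  assumes "bilinear_map scaleT scaleT (*) (f :: 't \<Rightarrow> 't \<Rightarrow> 'k)"
  shows "f (a + a') b = f a b + f a' b" "f a (b + b') = f a b + f a b'"
    "f (scaleT c a) b = c * f a b" "f a (scaleT c b) = c * f a b"
    "f 0 b = 0" "f a 0 = 0"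
proof -
  have l: "Vector_Spaces.linear scaleT (*) (\<lambda>x. f x y)" "Vector_Spaces.linear scaleT (*) (f x)" for x y
    using assms by (auto simp: bilinear_map_def)
  show "f (a + a') b = f a b + f a' b" "f a (b + b') = f a b + f a b'"
    "f (scaleT c a) b = c * f a b" "f a (scaleT c b) = c * f a b"
    using l unfolding Vector_Spaces.linear_iff by auto
  show "f 0 b = 0" "f a 0 = 0"
    using l(1)[of b] l(2)[of a] unfolding Vector_Spaces.linear_iff
    by (metis add_cancel_right_right)+
qed

lemma bilinear_scalarI:
  assumes "\<And>a a' b. f (a + a') b = f a b + f a' b" "\<And>a b b'. f a (b + b') = f a b + f a b'"
    "\<And>c a b. f (scaleT c a) b = c * f a b" "\<And>c a b. f a (scaleT c b) = c * f a b"
  shows "bilinear_map scaleT scaleT (*) (f :: 't \<Rightarrow> 't \<Rightarrow> 'k)"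
  using assms T.vector_space_axioms scalar_vector_space
  unfolding bilinear_map_def Vector_Spaces.linear_iff by auto

lemma sweedler_scalar_linear:
  assumes "bilinear_map scaleT scaleT (*) (f :: 't \<Rightarrow> 't \<Rightarrow> 'k)"
  shows "Vector_Spaces.linear scaleT (*) (sweedler UNIV comult f)"
proof -
  obtain g where lin: "Vector_Spaces.linear scaleTT (*) g" and g: "\<And>a b. g (a \<boxtimes> b) = f a b"
    using ex1_implies_ex[OF tens_universal[OF scalar_vector_space assms]] by blast
  interpret g: Vector_Spaces.linear scaleTT "(*)" g by fact
  have "sweedler UNIV comult f a = g (comult a)" for a
  proof -
    obtain ps where ps: "comult a = (\<Sum>(a, b)\<leftarrow>ps. a \<boxtimes> b)" using tens_decomposition by blast
    have "g (\<Sum>(a, b)\<leftarrow>rs. a \<boxtimes> b) = (\<Sum>(a, b)\<leftarrow>rs. f a b)" for rs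
      by (induction rs) (auto simp: g.zero g.add g)
    then show ?thesis using sweedler_eq[where A = UNIV and D = comult, OF scalar_vector_space assms _ ps] ps by simp
  qed
  moreover have "Vector_Spaces.linear scaleT (*) (\<lambda>a. g (comult a))"
    by (rule linear_comp[OF _ lin]) (use comult_hom in \<open>simp add: algebra_hom_def\<close>)
  ultimately show ?thesis by presburger
qed

lemma sweedler_scalar_one:
  assumes "bilinear_map scaleT scaleT (*) (f :: 't \<Rightarrow> 't \<Rightarrow> 'k)"
  shows "sweedler UNIV comult f 1 = f 1 1"
  using sweedler_eq[OF scalar_vector_space assms, of "[(1, 1)]" UNIV comult 1] comult_hom tens_one
  by (simp add: algebra_hom_def)

lemma sweedler_scalar_emb_mult:
  assumes f: "bilinear_map scaleT scaleT (*) (f :: 't \<Rightarrow> 't \<Rightarrow> 'k)"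
  shows "sweedler UNIV comult f (emb x * a) =
    sweedler UNIV comult (\<lambda>a b. f a (emb x * b) + f (emb x * a) b) a"
proof -
  obtain ps where ps: "comult a = (\<Sum>(a, b)\<leftarrow>ps. a \<boxtimes> b)" using tens_decomposition by blast
  let ?qs = "map (\<lambda>(a, b). (a, emb x * b)) ps @ map (\<lambda>(a, b). (emb x * a, b)) ps"
  have "(1 \<boxtimes> emb x + emb x \<boxtimes> 1) * (\<Sum>(a, b)\<leftarrow>qs. a \<boxtimes> b) =
    (\<Sum>(a, b)\<leftarrow>map (\<lambda>(a, b). (a, emb x * b)) qs @ map (\<lambda>(a, b). (emb x * a, b)) qs. a \<boxtimes> b)" for qs
    by (induction qs) (auto simp: tens_mult algebra_simps)
  then have qs: "comult (emb x * a) = (\<Sum>(a, b)\<leftarrow>?qs. a \<boxtimes> b)"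
    using comult_hom comult_emb ps by (metis algebra_hom_def)
  have f': "bilinear_map scaleT scaleT (*) (\<lambda>a b. f a (emb x * b) + f (emb x * a) b)"
    by (rule bilinear_scalarI)
      (simp_all add: bilinear_scalarD[OF f] algebra_simps T.scale_mult_right)
  have "(\<Sum>(a, b)\<leftarrow>map (\<lambda>(a, b). (a, emb x * b)) qs @ map (\<lambda>(a, b). (emb x * a, b)) qs. f a b) =
      (\<Sum>(a, b)\<leftarrow>qs. f a (emb x * b) + f (emb x * a) b)" for qs
    by (induction qs) (auto simp: algebra_simps)
  then show ?thesis
    using sweedler_eq[where A = UNIV and D = comult, OF scalar_vector_space f _ qs]
      sweedler_eq[where A = UNIV and D = comult, OF scalar_vector_space f' _ ps] by simp
qed

primrec contract_list :: "('u \<Rightarrow> 'k) \<Rightarrow> 'u list \<Rightarrow> 't" where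
  "contract_list \<phi> [] = 0"
| "contract_list \<phi> (y # ys) = scaleT (\<phi> y) (word ys) + emb y * contract_list \<phi> ys"

lemma contraction_ex:
  assumes phi: "Vector_Spaces.linear scaleU (*) \<phi>"
  shows "\<exists>d. Vector_Spaces.linear scaleT scaleT d \<and> d 1 = 0 \<and>
    (\<forall>y a. d (emb y * a) = scaleT (\<phi> y) a + emb y * d a)"
proof -
  interpret emb: Vector_Spaces.linear scaleU scaleT emb by (rule emb_linear)
  interpret phi: Vector_Spaces.linear scaleU "(*)" \<phi> by (rule phi)
  have "Vector_Spaces.linear scaleU scaleT (\<lambda>x. contract_list \<phi> (xs @ x # ys))" for xs ys
  proof (induction xs)
    case Nil
    show ?case unfolding Vector_Spaces.linear_iff
      by (auto simp: emb.add emb.scale phi.add phi.scale algebra_simps T.scale_mult_left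
          T.scale_left_distrib T.scale_right_distrib U.vector_space_axioms T.vector_space_axioms)
  next
    case (Cons z zs)
    have w: "word (zs @ x # ys) = word zs * emb x * word ys" for x by (simp add: mult.assoc)
    show ?case using Cons unfolding Vector_Spaces.linear_iff
      by (auto simp: w emb.add emb.scale algebra_simps T.scale_mult_left T.scale_mult_right
          T.scale_left_distrib T.scale_right_distrib simp del: map_append prod_list.append)
  qed
  then have "multilinear_on_lists scaleU scaleT (contract_list \<phi>)"
    by (simp add: multilinear_on_lists_def)
  from ex1_implies_ex[OF tensor_universal[OF T.vector_space_axioms this]] obtain d
    where lin: "Vector_Spaces.linear scaleT scaleT d"
      and d: "\<And>xs. d (word xs) = contract_list \<phi> xs" by blast
  interpret d: Vector_Spaces.linear scaleT scaleT d by fact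
  have "(\<lambda>a. d (emb y * a)) = (\<lambda>a. scaleT (\<phi> y) a + emb y * d a)" for y
  proof (rule linear_eq_on_words)
    show "Vector_Spaces.linear scaleT scaleT (\<lambda>a. d (emb y * a))"
      "Vector_Spaces.linear scaleT scaleT (\<lambda>a. scaleT (\<phi> y) a + emb y * d a)"
      unfolding Vector_Spaces.linear_iff
      by (auto simp: d.add d.scale T.vector_space_axioms algebra_simps T.scale_mult_right
          T.scale_right_distrib)
    show "d (emb y * word xs) = scaleT (\<phi> y) (word xs) + emb y * d (word xs)" for xs
      using d[of "y # xs"] d[of xs] by simp
  qed
  then have "d (emb y * a) = scaleT (\<phi> y) a + emb y * d a" for y a by metis
  with lin d[of "[]"] show ?thesis by (intro exI[of _ d]) simp
qed

lemma laplace_ex1: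
  assumes ip: "symmetric_bilinear_form scaleU ip"
  shows "\<exists>!L. is_laplace_pairing ip L"
proof (rule ex_ex1I)
  interpret ip: symmetric_bilinear_form scaleU ip by fact
  interpret emb: Vector_Spaces.linear scaleU scaleT emb by (rule emb_linear)
  have ip_lin: "Vector_Spaces.linear scaleU (*) (ip x)" for x
    using ip.form_bilinear by (simp add: bilinear_map_def)
  have ip_left: "ip (x + x') y = ip x y + ip x' y" "ip (scaleU c x) y = c * ip x y" for x x' y c
    using ip.form_bilinear by (auto simp: bilinear_map_def Vector_Spaces.linear_iff)
  have "\<exists>d. \<forall>x. Vector_Spaces.linear scaleT scaleT (d x) \<and> d x 1 = 0 \<and>
    (\<forall>y a. d x (emb y * a) = scaleT (ip x y) a + emb y * d x a)"
    using contraction_ex[OF ip_lin] by metis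
  then obtain d where d_lin: "\<And>x. Vector_Spaces.linear scaleT scaleT (d x)"
    and d1: "\<And>x. d x 1 = 0"
    and dm: "\<And>x y a. d x (emb y * a) = scaleT (ip x y) a + emb y * d x a" by blast
  have d_add: "d x (a + b) = d x a + d x b" and d_sc: "d x (scaleT c a) = scaleT c (d x a)" for x a b c
    using d_lin[of x] by (auto simp: Vector_Spaces.linear_iff)
  have d_vec: "d (x + x') = (\<lambda>a. d x a + d x' a)" for x x'
    by (rule linear_eq_on_emb_mult[OF d_lin])
      (auto simp: Vector_Spaces.linear_iff T.vector_space_axioms d_add d_sc T.scale_right_distrib
        T.scale_left_distrib d1 dm ip_left algebra_simps)
  have d_vsc: "d (scaleU c x) = (\<lambda>a. scaleT c (d x a))" for x c
    by (rule linear_eq_on_emb_mult[OF d_lin])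
      (auto simp: Vector_Spaces.linear_iff T.vector_space_axioms d_add d_sc T.scale_right_distrib
        T.scale_left_distrib d1 dm ip_left T.scale_mult_right mult.commute)
  have d_mult: "d x (a * b) = d x a * b + a * d x b" for x a b
    by (rule fun_cong[where x = a], rule linear_eq_on_emb_mult)
      (auto simp: Vector_Spaces.linear_iff T.vector_space_axioms d_add d_sc T.scale_right_distrib
        T.scale_mult_left T.scale_mult_right d1 dm algebra_simps)
  obtain e :: "'t \<Rightarrow> 'k" where e: "algebra_hom scaleT (*) e" "\<And>x. e (emb x) = 0"
  proof -
    have "unital_algebra ((*) :: 'k \<Rightarrow> 'k \<Rightarrow> 'k)" by unfold_locales (auto simp: algebra_simps)
    from ex1_implies_ex[OF tensor_algebra_universal[OF this, of "\<lambda>_. 0"]] show ?thesis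
      using that U.vector_space_axioms scalar_vector_space
      by (auto simp: Vector_Spaces.linear_iff)
  qed
  have e_add: "e (a + b) = e a + e b" and e_sc: "e (scaleT c a) = c * e a" and e1: "e 1 = 1"
    and e_mult: "e (a * b) = e a * e b" for a b c
    using e(1) by (auto simp: algebra_hom_def Vector_Spaces.linear_iff)
  define F where "F b xs = e (fold d xs b)" for b xs
  have F_lin: "Vector_Spaces.linear scaleT (*) (\<lambda>b. F b xs)" for xs
    unfolding F_def Vector_Spaces.linear_iff
  proof (safe)
    have "fold d xs (a + b) = fold d xs a + fold d xs b"
      "fold d xs (scaleT c a) = scaleT c (fold d xs a)" for a b c
      by (induction xs arbitrary: a b) (auto simp: d_add d_sc)
    then show "e (fold d xs (a + b)) = e (fold d xs a) + e (fold d xs b)"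
      "e (fold d xs (scaleT c a)) = c * e (fold d xs a)" for a b c
      by (auto simp: e_add e_sc)
  qed (rule T.vector_space_axioms scalar_vector_space)+
  have "multilinear_on_lists scaleU (*) (F b)" for b
  proof -
    have "Vector_Spaces.linear scaleU (*) (\<lambda>x. F b (xs @ x # ys))" for xs ys
    proof -
      have "F b (xs @ x # ys) = F (d x (fold d xs b)) ys" for x by (simp add: F_def)
      then show ?thesis
        using F_lin[of ys] unfolding Vector_Spaces.linear_iff
        by (auto simp: d_vec d_vsc U.vector_space_axioms)
    qed
    then show ?thesis by (simp add: multilinear_on_lists_def)
  qed
  then have "\<forall>b. \<exists>g. Vector_Spaces.linear scaleT (*) g \<and> (\<forall>xs. g (word xs) = F b xs)"
    using ex1_implies_ex[OF scalar_universal] by blast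
  from choice[OF this] obtain L' where L'_lin: "\<And>b. Vector_Spaces.linear scaleT (*) (L' b)"
    and L'_word: "\<And>b xs. L' b (word xs) = F b xs" by blast
  define L where "L a b = L' b a" for a b
  have L'_add: "L' (b + b') = (\<lambda>a. L' b a + L' b' a)" for b b'
    by (rule linear_eq_on_words[OF L'_lin])
      (use F_lin L'_lin in \<open>auto simp: L'_word Vector_Spaces.linear_iff algebra_simps\<close>)
  have L'_sc: "L' (scaleT c b) = (\<lambda>a. c * L' b a)" for b c
    by (rule linear_eq_on_words[OF L'_lin])
      (use F_lin L'_lin in \<open>auto simp: L'_word Vector_Spaces.linear_iff algebra_simps\<close>)
  have L: "bilinear_map scaleT scaleT (*) L"
    by (rule bilinear_scalarI)
      (use L'_lin in \<open>auto simp: L_def L'_add L'_sc Vector_Spaces.linear_iff\<close>)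
  note LD = bilinear_scalarD[OF L]
  have L_lin: "Vector_Spaces.linear scaleT (*) (\<lambda>a. L a b)" for b
    using L by (simp add: bilinear_map_def)
  have L1: "L 1 b = e b" for b
    using L'_word[of b "[]"] by (simp add: L_def F_def)
  have Lm: "L (emb x * a) b = L a (d x b)" for x a b
  proof -
    have "(\<lambda>a. L (emb x * a) b) = (\<lambda>a. L a (d x b))"
    proof (rule linear_eq_on_words)
      show "L (emb x * word xs) b = L (word xs) (d x b)" for xs
        using L'_word[of b "x # xs"] L'_word[of "d x b" xs] by (simp add: L_def F_def)
      show "Vector_Spaces.linear scaleT (*) (\<lambda>a. L (emb x * a) b)"
        unfolding Vector_Spaces.linear_iff
        by (auto simp: T.vector_space_axioms scalar_vector_space algebra_simps LD T.scale_mult_right)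
    qed (rule L_lin)
    then show ?thesis by metis
  qed
  have bil: "bilinear_map scaleT scaleT (*) (\<lambda>a1 a2. L a1 b * L a2 c)" for b c
    by (rule bilinear_scalarI) (auto simp: LD algebra_simps)
  have lap: "L a (b * c) = sweedler UNIV comult (\<lambda>a1 a2. L a1 b * L a2 c) a" for a b c
  proof -
    have "L (word xs) (b * c) = sweedler UNIV comult (\<lambda>a1 a2. L a1 b * L a2 c) (word xs)" for xs
    proof (induction xs arbitrary: b c)
      case Nil
      show ?case using sweedler_scalar_one[OF bil] by (simp add: L1 e_mult)
    next
      case (Cons x xs)
      have eq: "(\<lambda>a1 a2. L a1 b * L (emb x * a2) c + L (emb x * a1) b * L a2 c) =
         (\<lambda>a1 a2. L a1 b * L a2 (d x c) + L a1 (d x b) * L a2 c)"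
        by (simp add: Lm)
      have sum: "sweedler UNIV comult (\<lambda>a b. f a b + g a b) t =
        sweedler UNIV comult f t + sweedler UNIV comult g t" for f g :: "'t \<Rightarrow> 't \<Rightarrow> 'k" and t
        unfolding sweedler_def by (simp add: case_prod_unfold sum_list_addf)
      show ?case
        using Cons.IH[of b "d x c"] Cons.IH[of "d x b" c]
        by (simp add: Lm d_mult LD sweedler_scalar_emb_mult[OF bil] eq sum)
    qed
    then show ?thesis
      using linear_eq_on_words[OF L_lin sweedler_scalar_linear[OF bil], of "b * c" b c] by metis
  qed
  have adj: "L a (emb y * c) = L (d y a) c" for a y c
  proof -
    have "L (word xs) (emb y * c) = L (d y (word xs)) c" for xs
    proof (induction xs arbitrary: c)
      case Nil
      show ?case by (simp add: L1 e_mult e d1 LD)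
    next
      case (Cons x xs)
      show ?case using Cons.IH[of "d x c"] ip.form_sym[of x y]
        by (simp add: Lm dm LD)
    qed
    moreover have "Vector_Spaces.linear scaleT (*) (\<lambda>a. L (d y a) c)"
      by (rule linear_comp[OF d_lin L_lin])
    ultimately show ?thesis
      using linear_eq_on_words[OF L_lin, of "\<lambda>a. L (d y a) c" "emb y * c"] by metis
  qed
  have Le: "(\<lambda>a. L a 1) = e"
  proof (rule linear_eq_on_emb_mult[OF L_lin])
    show "Vector_Spaces.linear scaleT (*) e" using e by (simp add: algebra_hom_def)
  qed (simp_all add: L1 Lm d1 LD e_mult e)
  have sym: "L a b = L b a" for a b
  proof -
    have "L a (word ys) = L (word ys) a" for ys
    proof (induction ys arbitrary: a)
      case Nil
      show ?case using Le L1 by (simp add: fun_eq_iff)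
    next
      case (Cons y ys)
      then show ?case by (simp add: adj Lm)
    qed
    then show ?thesis
      using linear_eq_on_words[OF _ L_lin, of "L a" a] L by (metis bilinear_map_def)
  qed
  have "is_laplace_pairing ip L"
    unfolding is_laplace_pairing_def
  proof (intro conjI allI)
    show "L (emb x) (emb y) = ip x y" for x y
      using Lm[of x 1 "emb y"] dm[of x y 1] by (simp add: L1 d1 e_sc e1)
    show "L (emb x) 1 = 0" "L 1 (emb x) = 0" for x
      using L1[of "emb x"] Le e by (auto simp: fun_eq_iff)
  qed (use L lap L1 e1 in \<open>simp_all\<close>, rule sym)
  then show "\<exists>L. is_laplace_pairing ip L" by blast
next
  fix L M assume LM: "is_laplace_pairing ip L" "is_laplace_pairing ip M"
  have bil: "bilinear_map scaleT scaleT (*) X" and sym: "X a b = X b a"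
    and lap: "X a (b * c) = sweedler UNIV comult (\<lambda>a1 a2. X a1 b * X a2 c) a"
    and vals: "X 1 1 = 1" "X (emb x) 1 = 0" "X 1 (emb x) = 0" "X (emb x) (emb y) = ip x y"
    if "is_laplace_pairing ip X" for X a b c x y
    using that unfolding is_laplace_pairing_def by blast+
  have lin: "Vector_Spaces.linear scaleT (*) (\<lambda>a. X a b)" "Vector_Spaces.linear scaleT (*) (X b)"
    if "is_laplace_pairing ip X" for X b
    using bil[OF that] by (auto simp: bilinear_map_def)
  have prodbil: "bilinear_map scaleT scaleT (*) (\<lambda>a1 a2. X a1 b * X a2 c)"
    if "is_laplace_pairing ip X" for X b c
    by (rule bilinear_scalarI) (auto simp: bilinear_scalarD[OF bil[OF that]] algebra_simps)
  have one: "X 1 (b * c) = X 1 b * X 1 c" if "is_laplace_pairing ip X" for X b c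
    using lap[OF that] sweedler_scalar_one[OF prodbil[OF that]] by metis
  have embm: "X (emb x) (b * c) = X 1 b * X (emb x) c + X (emb x) b * X 1 c"
    if "is_laplace_pairing ip X" for X b c x
  proof -
    have "bilinear_map scaleT scaleT (*)
      (\<lambda>a1 a2. X a1 b * X (emb x * a2) c + X (emb x * a1) b * X a2 c)"
      by (rule bilinear_scalarI)
        (auto simp: bilinear_scalarD[OF bil[OF that]] algebra_simps T.scale_mult_right)
    from sweedler_scalar_one[OF this] show ?thesis
      using lap[OF that, of "emb x" b c] sweedler_scalar_emb_mult[OF prodbil[OF that], of b c x 1]
      by simp
  qed
  have eq1: "L 1 = M 1"
    by (rule linear_eq_on_emb_mult[OF lin(2)[OF LM(1)] lin(2)[OF LM(2)]])
      (simp_all add: vals LM one)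
  have eqx: "L (emb x) = M (emb x)" for x
    by (rule linear_eq_on_emb_mult[OF lin(2)[OF LM(1)] lin(2)[OF LM(2)]])
      (simp_all add: vals LM embm eq1)
  have "L a (word ys) = M a (word ys)" for a ys
  proof (induction ys arbitrary: a)
    case Nil
    show ?case using eq1 sym[OF LM(1)] sym[OF LM(2)] by simp
  next
    case (Cons y ys)
    have "L a (emb y) = M a (emb y)" for a
      using eqx sym[OF LM(1)] sym[OF LM(2)] by metis
    then show ?case using Cons by (simp add: lap LM)
  qed
  then show "L = M"
    using linear_eq_on_words[OF lin(2)[OF LM(1)] lin(2)[OF LM(2)]] by blast
qed


end

end

theory Submission
  imports Defs
begin

text \<open>
  The two products differ only in the co-multiplication and in a final \<open>Symm\<close>. As \<open>Symm\<close> is linear,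
  \<open>Symm (u \<box> v) = \<Sum> (u\<^sub>1|v\<^sub>1) Symm (u\<^sub>2 \<otimes> v\<^sub>2) = \<Sum> (u\<^sub>1|v\<^sub>1) u\<^sub>2 \<cdot> v\<^sub>2\<close>, where the components are those of
  \<open>\<Delta>\<close>. So everything rests on the fact that \<open>\<Delta>\<close> and \<open>\<Delta>\<^sub>s\<^sub>y\<^sub>m\<^sub>m = (Symm \<otimes> Symm) \<circ> \<Delta>\<close> agree on symmetric
  tensors (\<open>comult_symm_eq_comult\<close>): a decomposition of \<open>\<Delta>\<^sub>s\<^sub>y\<^sub>m\<^sub>m u\<close> into symmetric components then
  also computes the square product.

  Both maps are linear, so they need only be compared on a spanning set of the symmetric tensors.
  The powers \<open>x\<^sup>n\<close> of vectors \<open>x\<close> are one in characteristic 0, by the polarization identity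
  (\<open>TS_subset_span_powers\<close>), and there the comparison is immediate: \<open>1 \<otimes> x\<close> and \<open>x \<otimes> 1\<close> commute,
  hence \<open>\<Delta> (x\<^sup>n) = (1 \<otimes> x + x \<otimes> 1)\<^sup>n\<close> is a combination of the \<open>x\<^sup>i \<otimes> x\<^sup>j\<close>, which \<open>Symm \<otimes> Symm\<close> fixes.
\<close>

section \<open>Polarization in a noncommutative ring\<close>

lemma sum_power_eq_sum_words:
  fixes e :: "'i \<Rightarrow> 'a::ring_1"
  assumes "finite A"
  shows "(\<Sum>i\<in>A. e i) ^ n = (\<Sum>l | set l \<subseteq> A \<and> length l = n. prod_list (map e l))"
proof (induction n)
  case 0
  have "{l. set l \<subseteq> A \<and> length l = 0} = {[]}" by auto
  then show ?case by simp
next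
  case (Suc n)
  have "inj_on (\<lambda>(l, i). i # l) ({l. set l \<subseteq> A \<and> length l = n} \<times> A)"
    by (auto simp: inj_on_def)
  then have "(\<Sum>l | set l \<subseteq> A \<and> length l = Suc n. prod_list (map e l)) =
      (\<Sum>(l, i)\<in>{l. set l \<subseteq> A \<and> length l = n} \<times> A. e i * prod_list (map e l))"
    by (simp add: lists_length_Suc_eq sum.reindex case_prod_unfold)
  also have "\<dots> = (\<Sum>i\<in>A. e i) * (\<Sum>l | set l \<subseteq> A \<and> length l = n. prod_list (map e l))"
    unfolding sum.cartesian_product[symmetric] sum_product by (rule sum.swap)
  finally show ?case using Suc by simp
qed

text \<open>
  Expanding the powers into words, a word \<open>l\<close> over \<open>A\<close> receives the coefficient
  \<open>\<Sum> (-1)\<^bsup>|X|\<^esup>\<close> over the sets \<open>X \<subseteq> A\<close> of letters that \<open>l\<close> avoids. This sum factors as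
  \<open>\<Prod>\<^bsub>i\<in>A\<^esub> (1 - [i \<notin> l])\<close>, so exactly the words that use every letter of \<open>A\<close> survive. For
  \<open>n = |A|\<close> these are the arrangements of \<open>A\<close>, and the right-hand side is the sum over all
  permutations of the factors.
\<close>

lemma polarization:
  fixes e :: "'i \<Rightarrow> 'a::ring_1"
  assumes A: "finite A"
  shows "(\<Sum>X\<in>Pow A. (-1) ^ card X * (\<Sum>i\<in>A - X. e i) ^ n) =
    (\<Sum>l | set l = A \<and> length l = n. prod_list (map e l))"
proof -
  define W where "W = {l. set l \<subseteq> A \<and> length l = n}"
  have W: "finite W" unfolding W_def by (rule finite_lists_length_eq[OF A])
  \<comment> \<open>The product formula needs commutativity, so the coefficient is computed over \<^typ>\<open>int\<close>.\<close>
  have coeff: "(\<Sum>X\<in>Pow A. (-1) ^ card X * of_bool (set l \<inter> X = {})) = (of_bool (A \<subseteq> set l) :: 'a)"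
    for l
  proof -
    have "(\<Sum>X\<in>Pow A. (-1) ^ card X * of_bool (set l \<inter> X = {})) =
        (\<Sum>X\<in>Pow A. (-1) ^ card X * (\<Prod>i\<in>X. of_bool (i \<notin> set l)) * (\<Prod>i\<in>A - X. 1 :: int))"
    proof (rule sum.cong)
      fix X assume "X \<in> Pow A"
      then have "finite X" using A finite_subset by auto
      then have "(\<Prod>i\<in>X. of_bool (i \<notin> set l)) = (of_bool (set l \<inter> X = {}) :: int)"
        by (induction X) auto
      then show "(-1) ^ card X * of_bool (set l \<inter> X = {}) =
        (-1) ^ card X * (\<Prod>i\<in>X. of_bool (i \<notin> set l)) * (\<Prod>i\<in>A - X. 1 :: int)" by simp
    qed simp
    also have "\<dots> = (\<Prod>i\<in>A. 1 - of_bool (i \<notin> set l))"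
      using prod_diff_conv_sum[OF A, of "\<lambda>_. 1" "\<lambda>i. of_bool (i \<notin> set l) :: int"] by simp
    also have "\<dots> = (of_bool (A \<subseteq> set l) :: int)"
      using A by (induction A) auto
    finally have "(of_int (\<Sum>X\<in>Pow A. (-1) ^ card X * of_bool (set l \<inter> X = {})) :: 'a) =
        of_int (of_bool (A \<subseteq> set l))" by (rule arg_cong)
    then show ?thesis by simp
  qed
  have "(\<Sum>i\<in>A - X. e i) ^ n = (\<Sum>l\<in>W. of_bool (set l \<inter> X = {}) * prod_list (map e l))" for X
  proof -
    have "(\<Sum>i\<in>A - X. e i) ^ n = (\<Sum>l | set l \<subseteq> A - X \<and> length l = n. prod_list (map e l))"
      by (rule sum_power_eq_sum_words) (use A in simp)
    also have "\<dots> = (\<Sum>l\<in>W. of_bool (set l \<inter> X = {}) * prod_list (map e l))"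
      by (rule sum.mono_neutral_cong_left[OF W]) (auto simp: W_def)
    finally show ?thesis .
  qed
  then have "(\<Sum>X\<in>Pow A. (-1) ^ card X * (\<Sum>i\<in>A - X. e i) ^ n) =
      (\<Sum>X\<in>Pow A. \<Sum>l\<in>W. (-1) ^ card X * of_bool (set l \<inter> X = {}) * prod_list (map e l))"
    by (simp add: sum_distrib_left mult.assoc)
  also have "\<dots> = (\<Sum>l\<in>W. of_bool (A \<subseteq> set l) * prod_list (map e l))"
    by (subst sum.swap) (simp only: sum_distrib_right[symmetric] coeff)
  also have "\<dots> = (\<Sum>l | set l = A \<and> length l = n. prod_list (map e l))"
    by (rule sum.mono_neutral_cong_right[OF W]) (auto simp: W_def)
  finally show ?thesis .
qed

text \<open>
  By the pigeonhole principle, a word of length \<open>n\<close> that uses each of the letters \<open>0, \<dots>, n - 1\<close> is the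
  list of values of a permutation.
\<close>

lemma sum_permutes_eq_sum_words:
  "(\<Sum>p | p permutes {..<n}. f (map p [0..<n])) = (\<Sum>l | set l = {..<n} \<and> length l = n. f l)"
proof (rule sum.reindex_bij_betw)
  show "bij_betw (\<lambda>p. map p [0..<n]) {p. p permutes {..<n}} {l. set l = {..<n} \<and> length l = n}"
    unfolding bij_betw_def
  proof
    show "inj_on (\<lambda>p. map p [0..<n]) {p. p permutes {..<n}}"
    proof (rule inj_onI, rule ext)
      fix p q i
      assume p: "p \<in> {p. p permutes {..<n}}" and q: "q \<in> {p. p permutes {..<n}}"
        and eq: "map p [0..<n] = map q [0..<n]"
      show "p i = q i"
        using eq p q permutes_not_in[of p "{..<n}" i] permutes_not_in[of q "{..<n}" i]
        by (cases "i < n") auto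
    qed
    show "(\<lambda>p. map p [0..<n]) ` {p. p permutes {..<n}} = {l. set l = {..<n} \<and> length l = n}"
    proof (intro equalityI subsetI)
      fix l assume "l \<in> {l. set l = {..<n} \<and> length l = n}"
      then have l: "set l = {..<n}" "length l = n" by auto
      then have "distinct l" by (intro card_distinct) simp
      moreover have "set l = set [0..<n]" by (simp only: l(1) atLeast_upt)
      ultimately have "mset l = mset [0..<n]"
        using set_eq_iff_mset_eq_distinct[OF _ distinct_upt] by blast
      then obtain p where p: "p permutes {..<length [0..<n]}" "permute_list p [0..<n] = l"
        by (rule mset_eq_permutation)
      have "permute_list p [0..<n] = map p [0..<n]"
        unfolding permute_list_def length_upt diff_zero
        by (rule map_cong[OF refl]) (use permutes_in_image[OF p(1)] in simp)
      then have "l = map p [0..<n]" using p(2) by (simp only:)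
      then show "l \<in> (\<lambda>p. map p [0..<n]) ` {p. p permutes {..<n}}"
        using p(1) by (intro image_eqI) simp_all
    next
      fix l assume "l \<in> (\<lambda>p. map p [0..<n]) ` {p. p permutes {..<n}}"
      then obtain p where "p permutes {..<n}" "l = map p [0..<n]" by blast
      then show "l \<in> {l. set l = {..<n} \<and> length l = n}"
        by (simp add: permutes_image atLeast0LessThan)
    qed
  qed
qed

section \<open>The co-multiplication on symmetric tensors\<close>

context tensor_algebra_square
begin

lemma Symm_add: "Symm (a + b) = Symm a + Symm b"
  and Symm_scale: "Symm (scaleT c a) = scaleT c (Symm a)"
  using Symm_linear by (auto simp: Vector_Spaces.linear_iff)

lemma Symm_sum_list: "Symm (\<Sum>x\<leftarrow>xs. f x) = (\<Sum>x\<leftarrow>xs. Symm (f x))"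
proof -
  interpret S: Vector_Spaces.linear scaleT scaleT Symm by (rule Symm_linear)
  show ?thesis by (induction xs) (simp_all add: S.add)
qed

lemma Symm_emb_power: "Symm (emb x ^ n) = emb x ^ n"
proof -
  have word: "word (replicate n x) = emb x ^ n" by (induction n) auto
  have "permute_list p (replicate n x) = replicate n x" if "p permutes {..<n}" for p
    using permutes_in_image[OF that] by (intro nth_equalityI) (auto simp: permute_list_nth that)
  then have "Symm (emb x ^ n) = scaleT (1 / fact n) (\<Sum>p | p permutes {..<n}. emb x ^ n)"
    using Symm_word[of "replicate n x"] by (simp add: word)
  also have "\<dots> = scaleT (1 / fact n) (scaleT (fact n) (emb x ^ n))"
    by (simp add: card_permutations[OF refl finite_lessThan] T.sum_constant_scale del: sum_constant)
  finally show ?thesis by simp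
qed

text \<open>
  Up to the factor \<open>1/n!\<close>, \<open>Symm (x\<^sub>1 \<cdots> x\<^sub>n)\<close> is the right-hand side of \<open>polarization\<close> for the letters
  \<open>emb x\<^sub>i\<close>, and the left-hand side is a combination of \<open>n\<close>-th powers of sums of these vectors.
\<close>

lemma TS_subset_span_powers: "TS \<subseteq> T.span {emb x ^ n | x n. True}"
proof -
  let ?P = "T.span {emb x ^ n | x n. True}"
  interpret emb: Vector_Spaces.linear scaleU scaleT emb by (rule emb_linear)
  interpret S: Vector_Spaces.linear scaleT scaleT Symm by (rule Symm_linear)
  have "Symm (word xs) \<in> ?P" for xs
  proof -
    let ?n = "length xs" and ?e = "\<lambda>i. emb (xs ! i)"
    have "(\<Sum>p | p permutes {..<?n}. word (permute_list p xs)) =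
        (\<Sum>p | p permutes {..<?n}. prod_list (map ?e (map p [0..<?n])))"
      by (simp add: permute_list_def o_def)
    also have "\<dots> = (\<Sum>X\<in>Pow {..<?n}. (-1) ^ card X * (\<Sum>i\<in>{..<?n} - X. ?e i) ^ ?n)"
      by (simp only: sum_permutes_eq_sum_words[of "\<lambda>l. prod_list (map ?e l)"]
          polarization[OF finite_lessThan])
    also have "\<dots> \<in> ?P"
    proof (rule T.span_sum)
      fix X
      have "(\<Sum>i\<in>{..<?n} - X. ?e i) = emb (\<Sum>i\<in>{..<?n} - X. xs ! i)"
        by (simp add: emb.sum)
      then have "(\<Sum>i\<in>{..<?n} - X. ?e i) ^ ?n \<in> ?P" by (auto intro: T.span_base)
      then show "(-1) ^ card X * (\<Sum>i\<in>{..<?n} - X. ?e i) ^ ?n \<in> ?P"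
        by (cases "even (card X)") (auto intro: T.span_neg)
    qed
    finally show ?thesis by (simp add: Symm_word T.span_scale)
  qed
  then have "range word \<subseteq> Symm -` ?P" by auto
  then have "T.span (range word) \<subseteq> Symm -` ?P"
    by (intro T.span_minimal S.subspace_vimage T.subspace_span)
  then show ?thesis by (auto simp: words_span TS_def)
qed

lemma tensor_map_Symm:
  "Vector_Spaces.linear scaleTT scaleTT (tensor_map Symm Symm)"
  "tensor_map Symm Symm (a \<boxtimes> b) = Symm a \<boxtimes> Symm b"
  using theI'[OF tensor_map_ex1[OF Symm_linear Symm_linear]] unfolding tensor_map_def by blast+

lemma comult_power: "comult (a ^ n) = comult a ^ n"
  using comult_hom by (induction n) (auto simp: algebra_hom_def)

lemma comult_symm_emb_power: "comult_symm (emb x ^ n) = comult (emb x ^ n)"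
proof -
  let ?T = "tensor_map Symm Symm" and ?c = "1 \<boxtimes> emb x + emb x \<boxtimes> 1"
  interpret h: Vector_Spaces.linear scaleTT scaleTT ?T by (rule tensor_map_Symm)
  \<comment> \<open>A prefix \<open>x\<^sup>i \<boxtimes> x\<^sup>j\<close> absorbs one factor of the power at a time, which avoids binomial coefficients.\<close>
  have "?T ((emb x ^ i \<boxtimes> emb x ^ j) * ?c ^ n) = (emb x ^ i \<boxtimes> emb x ^ j) * ?c ^ n" for i j
  proof (induction n arbitrary: i j)
    case 0
    show ?case by (simp add: tensor_map_Symm Symm_emb_power)
  next
    case (Suc n)
    have "(emb x ^ i \<boxtimes> emb x ^ j) * ?c ^ Suc n =
        (emb x ^ i \<boxtimes> emb x ^ Suc j) * ?c ^ n + (emb x ^ Suc i \<boxtimes> emb x ^ j) * ?c ^ n"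
      by (simp add: mult.assoc[symmetric] distrib_left distrib_right tens_mult power_commutes)
    then show ?case by (simp only: h.add Suc)
  qed
  from this[of 0 0] show ?thesis
    by (simp add: comult_symm_def comult_power comult_emb tens_one[symmetric])
qed

text \<open>
  Symmetry of \<open>u\<close> is essential: \<open>\<Delta> (x \<otimes> y)\<close> contains \<open>1 \<boxtimes> (x \<otimes> y)\<close>, where \<open>\<Delta>\<^sub>s\<^sub>y\<^sub>m\<^sub>m (x \<otimes> y)\<close> contains
  \<open>1 \<boxtimes> Symm (x \<otimes> y)\<close>. For symmetric \<open>u\<close> the claim reduces by linearity to the powers \<open>x\<^sup>n\<close>.
\<close>

lemma comult_symm_eq_comult:
  assumes "u \<in> TS"
  shows "comult_symm u = comult u"
proof -
  have D: "Vector_Spaces.linear scaleT scaleTT comult"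
    using comult_hom by (simp add: algebra_hom_def)
  interpret P: vector_space_pair scaleT scaleTT ..
  show ?thesis
  proof (rule P.linear_eq_on)
    show "Vector_Spaces.linear scaleT scaleTT comult_symm"
      unfolding comult_symm_def o_def by (rule linear_comp[OF D tensor_map_Symm(1)])
    show "u \<in> T.span {emb x ^ n | x n. True}" using assms TS_subset_span_powers by blast
  qed (use D comult_symm_emb_power in auto)
qed

section \<open>The two products\<close>

lemma bilinear_mapI:
  assumes "\<And>a a' b. f (a + a') b = f a b + f a' b" "\<And>a b b'. f a (b + b') = f a b + f a b'"
    "\<And>c a b. f (scaleT c a) b = scaleT c (f a b)" "\<And>c a b. f a (scaleT c b) = scaleT c (f a b)"
  shows "bilinear_map scaleT scaleT scaleT f"
  using assms T.vector_space_axioms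
  unfolding bilinear_map_def Vector_Spaces.linear_iff by auto

text \<open>
  The square and circle products are both of this form, with \<open>m\<close> the respective product. Bilinearity
  in each pair of components makes the result independent of the decompositions, so that one
  pair of decompositions can serve both products.
\<close>

lemma sweedler_sweedler:
  assumes ps: "set ps \<subseteq> A \<times> A" "D u = (\<Sum>(a, b)\<leftarrow>ps. a \<boxtimes> b)"
    and qs: "set qs \<subseteq> A \<times> A" "D v = (\<Sum>(a, b)\<leftarrow>qs. a \<boxtimes> b)"
    and L: "bilinear_map scaleT scaleT (*) L" and m: "bilinear_map scaleT scaleT scaleT m"
  shows "sweedler A D (\<lambda>a1 a2. sweedler A D (\<lambda>b1 b2. scaleT (L a1 b1) (m a2 b2)) v) u =
    (\<Sum>(a1, a2)\<leftarrow>ps. \<Sum>(b1, b2)\<leftarrow>qs. scaleT (L a1 b1) (m a2 b2))"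
proof -
  have m_simps: "m (a + a') b = m a b + m a' b" "m a (b + b') = m a b + m a b'"
    "m (scaleT c a) b = scaleT c (m a b)" "m a (scaleT c b) = scaleT c (m a b)" for a a' b b' c
    using m by (auto simp: bilinear_map_def Vector_Spaces.linear_iff)
  note simps = bilinear_scalarD[OF L] m_simps T.scale_left_distrib T.scale_right_distrib
  have "bilinear_map scaleT scaleT scaleT (\<lambda>b1 b2. scaleT (L a1 b1) (m a2 b2))" for a1 a2
    by (rule bilinear_mapI) (simp_all add: simps mult.commute)
  from sweedler_eq[OF T.vector_space_axioms this, of qs A D v]
  have inner: "sweedler A D (\<lambda>b1 b2. scaleT (L a1 b1) (m a2 b2)) v =
      (\<Sum>(b1, b2)\<leftarrow>qs. scaleT (L a1 b1) (m a2 b2))" for a1 a2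
    using qs by blast
  have "bilinear_map scaleT scaleT scaleT
      (\<lambda>a1 a2. \<Sum>(b1, b2)\<leftarrow>qs. scaleT (L a1 b1) (m a2 b2))"
    by (rule bilinear_mapI; induction qs) (auto simp: simps mult.commute)
  from sweedler_eq[where D = D, OF T.vector_space_axioms this ps] show ?thesis by (simp only: inner)
qed

lemma Symm_square_prod:
  assumes ip: "symmetric_bilinear_form scaleU ip" and u: "u \<in> TS" and v: "v \<in> TS"
  shows "Symm (square_prod ip u v) = circle_prod ip u v"
proof -
  have L: "bilinear_map scaleT scaleT (*) (laplace ip)"
    using theI'[OF laplace_ex1[OF ip]] unfolding laplace_def is_laplace_pairing_def by blast
  obtain ps where ps: "set ps \<subseteq> TS \<times> TS" "comult_symm u = (\<Sum>(a, b)\<leftarrow>ps. a \<boxtimes> b)"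
    using comult_symm_decomposition by blast
  obtain qs where qs: "set qs \<subseteq> TS \<times> TS" "comult_symm v = (\<Sum>(a, b)\<leftarrow>qs. a \<boxtimes> b)"
    using comult_symm_decomposition by blast
  have mult: "bilinear_map scaleT scaleT scaleT (*)"
    by (rule bilinear_mapI) (simp_all add: algebra_simps T.scale_mult_left T.scale_mult_right)
  have sym_mult: "bilinear_map scaleT scaleT scaleT (\<odot>)"
    by (rule bilinear_mapI)
      (simp_all add: sym_mult_def algebra_simps T.scale_mult_left T.scale_mult_right
        Symm_add Symm_scale)
  have square: "square_prod ip u v =
      (\<Sum>(a1, a2)\<leftarrow>ps. \<Sum>(b1, b2)\<leftarrow>qs. scaleT (laplace ip a1 b1) (a2 * b2))"
    unfolding square_prod_def
    by (rule sweedler_sweedler[where m = "(*)" and D = comult])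
      (use ps qs u v L mult in \<open>simp_all add: comult_symm_eq_comult\<close>)
  have "Symm (square_prod ip u v) =
      (\<Sum>(a1, a2)\<leftarrow>ps. \<Sum>(b1, b2)\<leftarrow>qs. scaleT (laplace ip a1 b1) (a2 \<odot> b2))"
    by (simp add: square Symm_sum_list Symm_scale sym_mult_def case_prod_unfold)
  also have "\<dots> = circle_prod ip u v"
    unfolding circle_prod_def
    by (rule sweedler_sweedler[where D = comult_symm and u = u and v = v, OF ps qs L sym_mult,
          symmetric])
  finally show ?thesis .
qed

end

theorem lemma3p9:
  fixes scaleU :: "'k::real_normed_field \<Rightarrow> 'u::ab_group_add \<Rightarrow> 'u"
    and scaleT :: "'k \<Rightarrow> 't::ring_1 \<Rightarrow> 't"
    and emb :: "'u \<Rightarrow> 't"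
    and scaleTT :: "'k \<Rightarrow> 'tt::ring_1 \<Rightarrow> 'tt"
    and tens :: "'t \<Rightarrow> 't \<Rightarrow> 'tt"
    and ip :: "'u \<Rightarrow> 'u \<Rightarrow> 'k"
  assumes "tensor_algebra_square scaleU scaleT emb scaleTT tens"
    and "symmetric_bilinear_form scaleU ip"
    and "u \<in> tensor_algebra_square.TS scaleT emb"
    and "v \<in> tensor_algebra_square.TS scaleT emb"
  shows "tensor_algebra_square.Symm scaleT emb
           (tensor_algebra_square.square_prod scaleT emb scaleTT tens ip u v) =
         tensor_algebra_square.circle_prod scaleT emb scaleTT tens ip u v"
  by (rule tensor_algebra_square.Symm_square_prod[OF assms])

end
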